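(* Let $C=(E_j,j=0,\dots,n;\phi_i,i=1,\dots,n)$ be a holomorphic $(n+1)$-chain of type $t=(r_0,\dots,r_n;d_0,\dots,d_n)$ and let $\alpha=(0,\alpha_1,\dots,\alpha_n)\in\mathbb{R}^{n+1}$. For $i=0,\dots,n-1$ let $C_i:=(E_0,\dots,E_i,0,\dots,0)$ be the $i$-th standard subchain of $C$. If $C$ is $\alpha$-semistable (respectively $\alpha$-stable), then for every $i\in\{0,\dots,n-1\}$ for which $C_i$ is a non-trivial subchain, the condition on $\alpha$ arising from $C_i$ is $$(\alpha_1r_1+\cdots+\alpha_ir_i)(r_{i+1}+\cdots+r_n)-(\alpha_{i+1}r_{i+1}+\cdots+\alpha_nr_n)(r_0+\cdots+r_i)$$ $$\le\ (r_0+\cdots+r_i)(d_{i+1}+\cdots+d_n)-(r_{i+1}+\cdots+r_n)(d_0+\cdots+d_i)$$ (respectively the same inequality with $<$ in place of $\le$); in particular this inequality holds.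
   Context: $X$ is a compact Riemann surface (smooth projective complex curve) of genus $g\ge 2$. A holomorphic $(n+1)$-chain is a tuple $C=(E_j,j=0,\dots,n;\phi_i,i=1,\dots,n)$ of holomorphic vector bundles $E_j$ on $X$ and homomorphisms $\phi_i:E_i\to E_{i-1}$; its type is $(\operatorname{rk}E_0,\dots,\operatorname{rk}E_n;\deg E_0,\dots,\deg E_n)$. A subchain is a tuple $(F_0,\dots,F_n)$ of subsheaves $F_j\subseteq E_j$ with $\phi_i(F_i)\subseteq F_{i-1}$; the subchains $(0,\dots,0)$ and $(E_0,\dots,E_n)$ are called trivial. For $\alpha=(\alpha_0,\dots,\alpha_n)\in\mathbb{R}^{n+1}$ the $\alpha$-slope is $\mu_\alpha(C)=\frac{\sum_{j}(\deg E_j+\alpha_j\operatorname{rk}E_j)}{\sum_j\operatorname{rk}E_j}$. $C$ is $\alpha$-semistable (resp. $\alpha$-stable) if $\mu_\alpha(C')\le\mu_\alpha(C)$ (resp. $<$) for every non-trivial subchain $C'$. *)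

theory Defs
  imports
    "HOL-Complex_Analysis.Complex_Analysis"
    "HOL-Homology.Homology"
    "HOL-Algebra.Free_Abelian_Groups"
    "Jordan_Normal_Form.Determinant"
begin

section \<open>Compact Riemann surfaces\<close>

record 'a surface =
  stop :: "'a topology"
  charts :: "('a set \<times> ('a \<Rightarrow> complex)) set"

definition compact_riemann_surface :: "'a surface \<Rightarrow> bool" where
  "compact_riemann_surface X \<longleftrightarrow>
     topspace (stop X) \<noteq> {} \<and> compact_space (stop X) \<and> connected_space (stop X) \<and>
     Hausdorff_space (stop X) \<and>
     (\<Union>(U, z)\<in>charts X. U) = topspace (stop X) \<and>
     (\<forall>(U, z)\<in>charts X. openin (stop X) U \<and> open (z ` U) \<and>
        homeomorphic_map (subtopology (stop X) U) (top_of_set (z ` U)) z) \<and>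
     (\<forall>(U, z)\<in>charts X. \<forall>(V, w)\<in>charts X.
        (w \<circ> inv_into U z) holomorphic_on z ` (U \<inter> V))"

text \<open>The genus is the topological one: \<open>H\<^sub>1(X; Z)\<close> is free abelian of rank \<open>2g\<close>.\<close>

definition has_genus :: "'a surface \<Rightarrow> nat \<Rightarrow> bool" where
  "has_genus X g \<longleftrightarrow> homology_group 1 (stop X) \<cong> free_Abelian_group {..<2 * g}"

text \<open>Only the values of \<open>f\<close> on \<open>U\<close> are constrained.\<close>

definition holo_fun :: "'a surface \<Rightarrow> 'a set \<Rightarrow> ('a \<Rightarrow> complex) \<Rightarrow> bool" where
  "holo_fun X U f \<longleftrightarrow>
     (\<forall>(V, z)\<in>charts X. (f \<circ> inv_into V z) holomorphic_on z ` (U \<inter> V))"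

definition holo_mat :: "'a surface \<Rightarrow> 'a set \<Rightarrow> nat \<Rightarrow> nat \<Rightarrow> ('a \<Rightarrow> complex mat) \<Rightarrow> bool" where
  "holo_mat X U m n A \<longleftrightarrow>
     (\<forall>x\<in>U. A x \<in> carrier_mat m n) \<and>
     (\<forall>i<m. \<forall>j<n. holo_fun X U (\<lambda>x. Matrix.index_mat (A x) (i, j)))"


section \<open>Holomorphic vector bundles\<close>

text \<open>
  \<open>triv\<close> is a set of local trivialisations \<open>(U, \<psi>)\<close>, where \<open>\<psi>\<close> sends a point of the total space
  over \<open>U\<close> to its vector of fibre coordinates, so that \<open>e \<mapsto> (proj e, \<psi> e)\<close> identifies the part
  over \<open>U\<close> with \<open>U \<times> C\<^sup>r\<close>. The transition matrices are holomorphic, hence the topology and the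
  complex structure of the total space are the ones transported from the products \<open>U \<times> C\<^sup>r\<close>
  and need not be recorded. The vector space axioms of the fibres follow from the linearity and
  the bijectivity of \<open>\<psi>\<close>. The zero bundle (\<open>vrank = 0\<close>) is allowed.\<close>

record ('a, 'e) vbundle =
  total :: "'e set"
  proj :: "'e \<Rightarrow> 'a"
  fzero :: "'a \<Rightarrow> 'e"
  fadd :: "'e \<Rightarrow> 'e \<Rightarrow> 'e"
  fsmult :: "complex \<Rightarrow> 'e \<Rightarrow> 'e"
  vrank :: nat
  triv :: "('a set \<times> ('e \<Rightarrow> complex vec)) set"

definition fibre :: "('a, 'e) vbundle \<Rightarrow> 'a \<Rightarrow> 'e set" where
  "fibre E x = {e \<in> total E. proj E e = x}"

definition vector_bundle :: "'a surface \<Rightarrow> ('a, 'e) vbundle \<Rightarrow> bool" where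
  "vector_bundle X E \<longleftrightarrow>
     proj E ` total E \<subseteq> topspace (stop X) \<and>
     (\<forall>x\<in>topspace (stop X). fzero E x \<in> fibre E x \<and>
        (\<forall>a\<in>fibre E x. \<forall>b\<in>fibre E x. fadd E a b \<in> fibre E x) \<and>
        (\<forall>c. \<forall>a\<in>fibre E x. fsmult E c a \<in> fibre E x)) \<and>
     (\<Union>(U, \<psi>)\<in>triv E. U) = topspace (stop X) \<and>
     (\<forall>(U, \<psi>)\<in>triv E. openin (stop X) U \<and>
        (\<forall>x\<in>U. bij_betw \<psi> (fibre E x) (carrier_vec (vrank E)) \<and>
           \<psi> (fzero E x) = 0\<^sub>v (vrank E) \<and>
           (\<forall>a\<in>fibre E x. \<forall>b\<in>fibre E x. \<psi> (fadd E a b) = \<psi> a + \<psi> b) \<and>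
           (\<forall>c. \<forall>a\<in>fibre E x. \<psi> (fsmult E c a) = c \<cdot>\<^sub>v \<psi> a))) \<and>
     (\<forall>(U, \<psi>)\<in>triv E. \<forall>(V, \<theta>)\<in>triv E. \<exists>A. holo_mat X (U \<inter> V) (vrank E) (vrank E) A \<and>
        (\<forall>x\<in>U \<inter> V. \<forall>a\<in>fibre E x. \<theta> a = A x *\<^sub>v \<psi> a))"

definition bundle_hom ::
  "'a surface \<Rightarrow> ('a, 'e) vbundle \<Rightarrow> ('a, 'e) vbundle \<Rightarrow> ('e \<Rightarrow> 'e) \<Rightarrow> bool" where
  "bundle_hom X E E' \<phi> \<longleftrightarrow>
     (\<forall>x\<in>topspace (stop X). \<phi> ` fibre E x \<subseteq> fibre E' x) \<and>
     (\<forall>(U, \<psi>)\<in>triv E. \<forall>(V, \<theta>)\<in>triv E'. \<exists>A. holo_mat X (U \<inter> V) (vrank E') (vrank E) A \<and>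
        (\<forall>x\<in>U \<inter> V. \<forall>a\<in>fibre E x. \<theta> (\<phi> a) = A x *\<^sub>v \<psi> a))"


section \<open>Sheaves of sections\<close>

text \<open>A subsheaf of the sheaf of sections of \<open>E\<close> is given by its values \<open>F U\<close> on open sets \<open>U\<close>;
  the values at other sets are irrelevant. Sections over \<open>U\<close> are \<open>undefined\<close> outside \<open>U\<close>.\<close>

type_synonym ('a, 'e) subsheaf = "'a set \<Rightarrow> ('a \<Rightarrow> 'e) set"

definition sections :: "'a surface \<Rightarrow> ('a, 'e) vbundle \<Rightarrow> ('a, 'e) subsheaf" where
  "sections X E U = {s \<in> (\<Pi>\<^sub>E x\<in>U. fibre E x).
     \<forall>(V, \<psi>)\<in>triv E. \<forall>i<vrank E. holo_fun X (U \<inter> V) (\<lambda>x. Matrix.vec_index (\<psi> (s x)) i)}"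

definition zero_sheaf :: "('a, 'e) vbundle \<Rightarrow> ('a, 'e) subsheaf" where
  "zero_sheaf E U = {\<lambda>x\<in>U. fzero E x}"

definition sheaf_eq :: "'a surface \<Rightarrow> ('a, 'e) subsheaf \<Rightarrow> ('a, 'e) subsheaf \<Rightarrow> bool" where
  "sheaf_eq X F G \<longleftrightarrow> (\<forall>U. openin (stop X) U \<longrightarrow> F U = G U)"

text \<open>\<open>lincomb E x k c v\<close> is \<open>c 0 \<cdot> v 0 + \<dots> + c (k - 1) \<cdot> v (k - 1)\<close> in the fibre over \<open>x\<close>.\<close>

primrec lincomb ::
  "('a, 'e) vbundle \<Rightarrow> 'a \<Rightarrow> nat \<Rightarrow> (nat \<Rightarrow> complex) \<Rightarrow> (nat \<Rightarrow> 'e) \<Rightarrow> 'e" where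
  "lincomb E x 0 c v = fzero E x"
| "lincomb E x (Suc k) c v = fadd E (lincomb E x k c v) (fsmult E (c k) (v k))"

definition module_subsheaf :: "'a surface \<Rightarrow> ('a, 'e) vbundle \<Rightarrow> ('a, 'e) subsheaf \<Rightarrow> bool" where
  "module_subsheaf X E F \<longleftrightarrow>
     (\<forall>U. openin (stop X) U \<longrightarrow>
        F U \<subseteq> sections X E U \<and>
        (\<lambda>x\<in>U. fzero E x) \<in> F U \<and>
        (\<forall>s\<in>F U. \<forall>t\<in>F U. (\<lambda>x\<in>U. fadd E (s x) (t x)) \<in> F U) \<and>
        (\<forall>f. \<forall>s\<in>F U. holo_fun X U f \<longrightarrow> (\<lambda>x\<in>U. fsmult E (f x) (s x)) \<in> F U) \<and>
        (\<forall>V. openin (stop X) V \<and> V \<subseteq> U \<longrightarrow> (\<forall>s\<in>F U. restrict s V \<in> F V))) \<and>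
     (\<forall>\<U> s. (\<forall>U\<in>\<U>. openin (stop X) U \<and> restrict s U \<in> F U) \<and> s \<in> extensional (\<Union>\<U>) \<longrightarrow>
        s \<in> F (\<Union>\<U>))"

text \<open>A submodule of finite type of a locally free sheaf is coherent (Oka).\<close>

definition coherent_subsheaf :: "'a surface \<Rightarrow> ('a, 'e) vbundle \<Rightarrow> ('a, 'e) subsheaf \<Rightarrow> bool" where
  "coherent_subsheaf X E F \<longleftrightarrow> module_subsheaf X E F \<and>
     (\<forall>p\<in>topspace (stop X). \<exists>U k e. openin (stop X) U \<and> p \<in> U \<and> (\<forall>i<k. e i \<in> F U) \<and>
        (\<forall>V t q. openin (stop X) V \<and> V \<subseteq> U \<and> t \<in> F V \<and> q \<in> V \<longrightarrow>
           (\<exists>W a. openin (stop X) W \<and> q \<in> W \<and> W \<subseteq> V \<and> (\<forall>i<k. holo_fun X W (a i)) \<and>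
              (\<forall>x\<in>W. t x = lincomb E x k (\<lambda>i. a i x) (\<lambda>i. e i x)))))"


section \<open>Rank and degree\<close>

text \<open>On a Riemann surface every coherent subsheaf of a locally free sheaf is locally free, so
  its rank and degree can be read off from local frames.\<close>

definition local_frame ::
  "'a surface \<Rightarrow> ('a, 'e) vbundle \<Rightarrow> ('a, 'e) subsheaf \<Rightarrow> nat \<Rightarrow> 'a set \<Rightarrow> (nat \<Rightarrow> 'a \<Rightarrow> 'e) \<Rightarrow> bool"
where
  "local_frame X E F k U e \<longleftrightarrow> openin (stop X) U \<and> (\<forall>i<k. e i \<in> F U) \<and>
     (\<forall>V. openin (stop X) V \<and> V \<subseteq> U \<longrightarrow>
        (\<forall>t\<in>F V. \<exists>a. (\<forall>i<k. holo_fun X V (a i)) \<and>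
           (\<forall>x\<in>V. t x = lincomb E x k (\<lambda>i. a i x) (\<lambda>i. e i x))) \<and>
        (\<forall>a. (\<forall>i<k. holo_fun X V (a i)) \<and>
           (\<forall>x\<in>V. lincomb E x k (\<lambda>i. a i x) (\<lambda>i. e i x) = fzero E x) \<longrightarrow>
           (\<forall>i<k. \<forall>x\<in>V. a i x = 0)))"

definition sheaf_rank :: "'a surface \<Rightarrow> ('a, 'e) vbundle \<Rightarrow> ('a, 'e) subsheaf \<Rightarrow> nat" where
  "sheaf_rank X E F =
     (THE k. \<forall>p\<in>topspace (stop X). \<exists>U e. p \<in> U \<and> local_frame X E F k U e)"

text \<open>
  \<open>wedge_order X E F k S s p m\<close>: the sections \<open>s 0, \<dots>, s (k - 1)\<close> of \<open>F\<close> over the complement of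
  the finite set \<open>S\<close> are meromorphic at \<open>p\<close>, and \<open>s 0 \<and> \<dots> \<and> s (k - 1)\<close>, regarded as a
  meromorphic section of the line bundle \<open>det F\<close>, is not identically zero near \<open>p\<close> and has order
  \<open>m\<close> there. In terms of a local frame \<open>e\<close> of \<open>F\<close> with \<open>s i = (\<Sum>j. a i j \<cdot> e j)\<close>, this section is
  \<open>det a \<cdot> (e 0 \<and> \<dots> \<and> e (k - 1))\<close>.\<close>

definition wedge_order ::
  "'a surface \<Rightarrow> ('a, 'e) vbundle \<Rightarrow> ('a, 'e) subsheaf \<Rightarrow> nat \<Rightarrow> 'a set \<Rightarrow> (nat \<Rightarrow> 'a \<Rightarrow> 'e) \<Rightarrow>
   'a \<Rightarrow> int \<Rightarrow> bool" where
  "wedge_order X E F k S s p m \<longleftrightarrow>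
     (\<exists>U e a. \<exists>(V, z)\<in>charts X. p \<in> U \<and> p \<in> V \<and> local_frame X E F k U e \<and>
        (\<forall>i<k. \<forall>j<k. holo_fun X (U - S) (a i j) \<and> (a i j \<circ> inv_into V z) meromorphic_on {z p}) \<and>
        (\<forall>i<k. \<forall>x\<in>U - S. s i x = lincomb E x k (\<lambda>j. a i j x) (\<lambda>j. e j x)) \<and>
        (let f = (\<lambda>w. Determinant.det (Matrix.mat k k (\<lambda>(i, j). a i j (inv_into V z w))))
         in (\<exists>\<^sub>F w in at (z p). f w \<noteq> 0) \<and> m = zorder f (z p)))"

text \<open>The degree of \<open>F\<close> is the degree of \<open>det F\<close>, that is, of the divisor of a nonzero meromorphic
  section of \<open>det F\<close>, here of the form \<open>s 0 \<and> \<dots> \<and> s (k - 1)\<close> for \<open>k = rk F\<close> generically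
  independent meromorphic sections of \<open>F\<close>. Such sections always exist, and the degree of the
  divisor does not depend on them because a meromorphic function on \<open>X\<close> has as many zeros as
  poles.\<close>

definition sheaf_degree :: "'a surface \<Rightarrow> ('a, 'e) vbundle \<Rightarrow> ('a, 'e) subsheaf \<Rightarrow> int" where
  "sheaf_degree X E F =
     (THE d. \<exists>S s ord. finite S \<and> S \<subseteq> topspace (stop X) \<and>
        (\<forall>i<sheaf_rank X E F. s i \<in> F (topspace (stop X) - S)) \<and>
        (\<forall>p\<in>topspace (stop X). wedge_order X E F (sheaf_rank X E F) S s p (ord p)) \<and>
        finite {p \<in> topspace (stop X). ord p \<noteq> 0} \<and>
        d = (\<Sum>p | p \<in> topspace (stop X) \<and> ord p \<noteq> 0. ord p))"

definition bundle_degree :: "'a surface \<Rightarrow> ('a, 'e) vbundle \<Rightarrow> int" where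
  "bundle_degree X E = sheaf_degree X E (sections X E)"


section \<open>Holomorphic chains and stability\<close>

text \<open>The chain has the bundles \<open>E 0, \<dots>, E n\<close> and the maps \<open>\<phi> i : E i \<rightarrow> E (i - 1)\<close> for
  \<open>i = 1, \<dots>, n\<close>. Other indices are irrelevant.\<close>

definition holomorphic_chain ::
  "'a surface \<Rightarrow> nat \<Rightarrow> (nat \<Rightarrow> ('a, 'e) vbundle) \<Rightarrow> (nat \<Rightarrow> 'e \<Rightarrow> 'e) \<Rightarrow> bool" where
  "holomorphic_chain X n E \<phi> \<longleftrightarrow>
     (\<forall>j\<le>n. vector_bundle X (E j)) \<and> (\<forall>i\<in>{1..n}. bundle_hom X (E i) (E (i - 1)) (\<phi> i))"

definition chain_type ::
  "'a surface \<Rightarrow> nat \<Rightarrow> (nat \<Rightarrow> ('a, 'e) vbundle) \<Rightarrow> (nat \<Rightarrow> nat) \<Rightarrow> (nat \<Rightarrow> int) \<Rightarrow> bool" where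
  "chain_type X n E r d \<longleftrightarrow> (\<forall>j\<le>n. vrank (E j) = r j \<and> bundle_degree X (E j) = d j)"

definition subchain ::
  "'a surface \<Rightarrow> nat \<Rightarrow> (nat \<Rightarrow> ('a, 'e) vbundle) \<Rightarrow> (nat \<Rightarrow> 'e \<Rightarrow> 'e) \<Rightarrow>
   (nat \<Rightarrow> ('a, 'e) subsheaf) \<Rightarrow> bool" where
  "subchain X n E \<phi> F \<longleftrightarrow>
     (\<forall>j\<le>n. coherent_subsheaf X (E j) (F j)) \<and>
     (\<forall>i\<in>{1..n}. \<forall>U. openin (stop X) U \<longrightarrow> (\<forall>s\<in>F i U. (\<lambda>x\<in>U. \<phi> i (s x)) \<in> F (i - 1) U))"

definition nontrivial_subchain ::
  "'a surface \<Rightarrow> nat \<Rightarrow> (nat \<Rightarrow> ('a, 'e) vbundle) \<Rightarrow> (nat \<Rightarrow> 'e \<Rightarrow> 'e) \<Rightarrow>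
   (nat \<Rightarrow> ('a, 'e) subsheaf) \<Rightarrow> bool" where
  "nontrivial_subchain X n E \<phi> F \<longleftrightarrow> subchain X n E \<phi> F \<and>
     \<not> (\<forall>j\<le>n. sheaf_eq X (F j) (zero_sheaf (E j))) \<and>
     \<not> (\<forall>j\<le>n. sheaf_eq X (F j) (sections X (E j)))"

definition standard_subchain ::
  "'a surface \<Rightarrow> (nat \<Rightarrow> ('a, 'e) vbundle) \<Rightarrow> nat \<Rightarrow> nat \<Rightarrow> ('a, 'e) subsheaf" where
  "standard_subchain X E i j = (if j \<le> i then sections X (E j) else zero_sheaf (E j))"

definition slope :: "nat \<Rightarrow> (nat \<Rightarrow> real) \<Rightarrow> (nat \<Rightarrow> nat) \<Rightarrow> (nat \<Rightarrow> int) \<Rightarrow> real" where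
  "slope n \<alpha> r d = (\<Sum>j\<le>n. real_of_int (d j) + \<alpha> j * real (r j)) / (\<Sum>j\<le>n. real (r j))"

definition chain_slope ::
  "'a surface \<Rightarrow> nat \<Rightarrow> (nat \<Rightarrow> real) \<Rightarrow> (nat \<Rightarrow> ('a, 'e) vbundle) \<Rightarrow> real" where
  "chain_slope X n \<alpha> E = slope n \<alpha> (\<lambda>j. vrank (E j)) (\<lambda>j. bundle_degree X (E j))"

definition subchain_slope ::
  "'a surface \<Rightarrow> nat \<Rightarrow> (nat \<Rightarrow> real) \<Rightarrow> (nat \<Rightarrow> ('a, 'e) vbundle) \<Rightarrow>
   (nat \<Rightarrow> ('a, 'e) subsheaf) \<Rightarrow> real" where
  "subchain_slope X n \<alpha> E F =
     slope n \<alpha> (\<lambda>j. sheaf_rank X (E j) (F j)) (\<lambda>j. sheaf_degree X (E j) (F j))"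

definition semistable_chain ::
  "'a surface \<Rightarrow> nat \<Rightarrow> (nat \<Rightarrow> real) \<Rightarrow> (nat \<Rightarrow> ('a, 'e) vbundle) \<Rightarrow> (nat \<Rightarrow> 'e \<Rightarrow> 'e) \<Rightarrow> bool"
where
  "semistable_chain X n \<alpha> E \<phi> \<longleftrightarrow>
     (\<forall>F. nontrivial_subchain X n E \<phi> F \<longrightarrow> subchain_slope X n \<alpha> E F \<le> chain_slope X n \<alpha> E)"

definition stable_chain ::
  "'a surface \<Rightarrow> nat \<Rightarrow> (nat \<Rightarrow> real) \<Rightarrow> (nat \<Rightarrow> ('a, 'e) vbundle) \<Rightarrow> (nat \<Rightarrow> 'e \<Rightarrow> 'e) \<Rightarrow> bool"
where
  "stable_chain X n \<alpha> E \<phi> \<longleftrightarrow>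
     (\<forall>F. nontrivial_subchain X n E \<phi> F \<longrightarrow> subchain_slope X n \<alpha> E F < chain_slope X n \<alpha> E)"

end

theory Submission
  imports Defs
begin

text \<open>
  The standard subchain \<open>C\<^sub>i\<close> has ranks \<open>(r\<^sub>0, \<dots>, r\<^sub>i, 0, \<dots>, 0)\<close> and degrees
  \<open>(d\<^sub>0, \<dots>, d\<^sub>i, 0, \<dots>, 0)\<close>. The rank of a locally free sheaf is well defined because two local
  frames of lengths \<open>k\<close> and \<open>l\<close> at a point give matrices \<open>b \<in> C\<^bsup>k\<times>l\<^esup>\<close>, \<open>c \<in> C\<^bsup>l\<times>k\<^esup>\<close> with
  \<open>b c = 1\<close>, so that \<open>k \<le> l\<close>. Nontriviality makes both \<open>r\<^sub>0 + \<dots> + r\<^sub>i\<close> and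
  \<open>r\<^bsub>i+1\<^esub> + \<dots> + r\<^sub>n\<close> positive, and clearing denominators in the slope inequality gives the
  condition on \<open>\<alpha>\<close>.\<close>

section \<open>Sizes of matrices with a one-sided inverse\<close>

text \<open>If \<open>l < k\<close>, padding with zeros turns \<open>b\<close> and \<open>c\<close>
  into square matrices with the same product. A right inverse of a square matrix is also a left
  inverse, but \<open>C * B\<close> has a zero row.\<close>

lemma right_inverse_imp_le:
  fixes b c :: "nat \<Rightarrow> nat \<Rightarrow> 'a :: field"
  assumes "\<And>i j. i < k \<Longrightarrow> j < k \<Longrightarrow> (\<Sum>m<l. b i m * c m j) = (if i = j then 1 else 0)"
  shows "k \<le> l"
proof (rule ccontr)
  assume "\<not> k \<le> l"
  hence lk: "l < k" by simp
  define B where "B = Matrix.mat k k (\<lambda>(i, j). if j < l then b i j else 0)"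
  define C where "C = Matrix.mat k k (\<lambda>(i, j). if i < l then c i j else 0)"
  have carr: "B \<in> carrier_mat k k" "C \<in> carrier_mat k k"
    by (auto simp: B_def C_def)
  have "B * C = 1\<^sub>m k"
  proof (rule eq_matI)
    fix i j assume ij: "i < dim_row (1\<^sub>m k :: 'a mat)" "j < dim_col (1\<^sub>m k :: 'a mat)"
    have "Matrix.index_mat (B * C) (i, j) =
        (\<Sum>m = 0..<k. (if m < l then b i m else 0) * (if m < l then c m j else 0))"
      using ij by (simp add: B_def C_def scalar_prod_def)
    also have "\<dots> = (\<Sum>m<l. b i m * c m j)"
      using lk by (intro sum.mono_neutral_cong_right) auto
    finally show "Matrix.index_mat (B * C) (i, j) = Matrix.index_mat (1\<^sub>m k) (i, j)"
      using ij assms by simp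
  qed (auto simp: B_def C_def)
  hence "C * B = 1\<^sub>m k"
    using mat_mult_left_right_inverse[OF carr] by simp
  \<comment> \<open>Rows are counted from 0, so \<open>l\<close> is the first padded row of
    \<open>C\<close>; it exists because \<open>l < k\<close>.\<close>
  moreover have "Matrix.index_mat (C * B) (l, l) = 0"
    using lk by (simp add: B_def C_def scalar_prod_def)
  ultimately show False using lk by simp
qed

section \<open>Holomorphic functions in charts\<close>

text \<open>Injectivity makes \<open>inv_into V z\<close> undo \<open>z\<close> on \<open>V\<close>.
  Hence holomorphy of a function on \<open>U\<close>, which is tested after composition with
  \<open>inv_into V z\<close>, depends only on its values on \<open>U\<close>.\<close>

lemma chart_inj_on:
  assumes "compact_riemann_surface X" "(V, z) \<in> charts X"
  shows "inj_on z V"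
proof -
  have op: "openin (stop X) V"
    and h: "homeomorphic_map (subtopology (stop X) V) (top_of_set (z ` V)) z"
    using assms unfolding compact_riemann_surface_def by fastforce+
  have "topspace (subtopology (stop X) V) = V"
    using openin_subset[OF op] by auto
  thus ?thesis
    using homeomorphic_imp_injective_map[OF h] by simp
qed

lemma holo_fun_cong:
  assumes "compact_riemann_surface X" "\<And>x. x \<in> U \<Longrightarrow> f x = h x" "holo_fun X U f"
  shows "holo_fun X U h"
  unfolding holo_fun_def
proof safe
  fix V z assume Vz: "(V, z) \<in> charts X"
  have inj: "inj_on z V" by (rule chart_inj_on[OF assms(1) Vz])
  have "(f \<circ> inv_into V z) holomorphic_on z ` (U \<inter> V)"
    using assms(3) Vz unfolding holo_fun_def by auto
  moreover have "(f \<circ> inv_into V z) w = (h \<circ> inv_into V z) w" if "w \<in> z ` (U \<inter> V)" for w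
    using that assms(2) inj by auto
  ultimately show "(h \<circ> inv_into V z) holomorphic_on z ` (U \<inter> V)"
    using holomorphic_transform by blast
qed

lemma holo_fun_subset:
  assumes "holo_fun X U f" "V \<subseteq> U"
  shows "holo_fun X V f"
  unfolding holo_fun_def
proof safe
  fix W z assume "(W, z) \<in> charts X"
  hence "(f \<circ> inv_into W z) holomorphic_on z ` (U \<inter> W)"
    using assms(1) unfolding holo_fun_def by auto
  thus "(f \<circ> inv_into W z) holomorphic_on z ` (V \<inter> W)"
    by (rule holomorphic_on_subset) (use assms(2) in auto)
qed

lemma holo_fun_const: "holo_fun X U (\<lambda>x. c)"
  unfolding holo_fun_def by (auto simp: o_def)

lemma holo_fun_mult:
  "holo_fun X U f \<Longrightarrow> holo_fun X U h \<Longrightarrow> holo_fun X U (\<lambda>x. f x * h x)"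
  unfolding holo_fun_def o_def by (auto intro!: holomorphic_on_mult)

lemma holo_fun_diff:
  "holo_fun X U f \<Longrightarrow> holo_fun X U h \<Longrightarrow> holo_fun X U (\<lambda>x. f x - h x)"
  unfolding holo_fun_def o_def by (auto intro!: holomorphic_on_diff)

lemma holo_fun_sum:
  "(\<And>i. i \<in> I \<Longrightarrow> holo_fun X U (f i)) \<Longrightarrow> holo_fun X U (\<lambda>x. \<Sum>i\<in>I. f i x)"
  unfolding holo_fun_def o_def by (auto intro!: holomorphic_on_sum)

section \<open>Fibres and their coordinates\<close>

lemma trivialisation_exists:
  assumes "vector_bundle X E" "x \<in> topspace (stop X)"
  obtains U \<psi> where "(U, \<psi>) \<in> triv E" "x \<in> U"
proof -
  have "(\<Union>(U, \<psi>)\<in>triv E. U) = topspace (stop X)"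
    using assms(1) unfolding vector_bundle_def by (elim conjE)
  thus ?thesis using assms(2) that by auto
qed

lemma trivialisation:
  assumes "vector_bundle X E" "(U, \<psi>) \<in> triv E"
  shows trivialisation_open: "openin (stop X) U"
    and trivialisation_bij: "x \<in> U \<Longrightarrow> bij_betw \<psi> (fibre E x) (carrier_vec (vrank E))"
    and trivialisation_zero: "x \<in> U \<Longrightarrow> \<psi> (fzero E x) = 0\<^sub>v (vrank E)"
    and trivialisation_add:
      "x \<in> U \<Longrightarrow> a \<in> fibre E x \<Longrightarrow> b \<in> fibre E x \<Longrightarrow> \<psi> (fadd E a b) = \<psi> a + \<psi> b"
    and trivialisation_smult: "x \<in> U \<Longrightarrow> a \<in> fibre E x \<Longrightarrow> \<psi> (fsmult E s a) = s \<cdot>\<^sub>v \<psi> a"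
proof -
  have "\<forall>(U, \<psi>)\<in>triv E. openin (stop X) U \<and>
        (\<forall>x\<in>U. bij_betw \<psi> (fibre E x) (carrier_vec (vrank E)) \<and>
           \<psi> (fzero E x) = 0\<^sub>v (vrank E) \<and>
           (\<forall>a\<in>fibre E x. \<forall>b\<in>fibre E x. \<psi> (fadd E a b) = \<psi> a + \<psi> b) \<and>
           (\<forall>c. \<forall>a\<in>fibre E x. \<psi> (fsmult E c a) = c \<cdot>\<^sub>v \<psi> a))"
    using assms(1) unfolding vector_bundle_def by (elim conjE)
  note * = bspec[OF this assms(2), unfolded prod.case]
  show "openin (stop X) U" using * by (rule conjunct1)
  note x = bspec[OF conjunct2[OF *]]
  show "bij_betw \<psi> (fibre E x) (carrier_vec (vrank E))" if "x \<in> U"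
    using x[OF that] by (elim conjE)
  show "\<psi> (fzero E x) = 0\<^sub>v (vrank E)" if "x \<in> U"
    using x[OF that] by (elim conjE)
  show "\<psi> (fadd E a b) = \<psi> a + \<psi> b" if "x \<in> U" "a \<in> fibre E x" "b \<in> fibre E x"
    using x[OF that(1)] that(2,3) by simp
  show "\<psi> (fsmult E s a) = s \<cdot>\<^sub>v \<psi> a" if "x \<in> U" "a \<in> fibre E x"
    using x[OF that(1)] that(2) by simp
qed

lemma transition_matrix:
  assumes "vector_bundle X E" "(U, \<psi>) \<in> triv E" "(V, \<theta>) \<in> triv E"
  obtains A where "holo_mat X (U \<inter> V) (vrank E) (vrank E) A"
    "\<And>x a. x \<in> U \<inter> V \<Longrightarrow> a \<in> fibre E x \<Longrightarrow> \<theta> a = A x *\<^sub>v \<psi> a"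
proof -
  have "\<forall>(U, \<psi>)\<in>triv E. \<forall>(V, \<theta>)\<in>triv E. \<exists>A. holo_mat X (U \<inter> V) (vrank E) (vrank E) A \<and>
        (\<forall>x\<in>U \<inter> V. \<forall>a\<in>fibre E x. \<theta> a = A x *\<^sub>v \<psi> a)"
    using assms(1) unfolding vector_bundle_def by (elim conjE)
  from bspec[OF bspec[OF this assms(2), unfolded prod.case] assms(3)] show ?thesis
    using that by auto
qed

lemma fibre_closed:
  assumes "vector_bundle X E" "x \<in> topspace (stop X)"
  shows fibre_zero: "fzero E x \<in> fibre E x"
    and fibre_add: "a \<in> fibre E x \<Longrightarrow> b \<in> fibre E x \<Longrightarrow> fadd E a b \<in> fibre E x"
    and fibre_smult: "a \<in> fibre E x \<Longrightarrow> fsmult E s a \<in> fibre E x"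
proof -
  have "\<forall>x\<in>topspace (stop X). fzero E x \<in> fibre E x \<and>
        (\<forall>a\<in>fibre E x. \<forall>b\<in>fibre E x. fadd E a b \<in> fibre E x) \<and>
        (\<forall>c. \<forall>a\<in>fibre E x. fsmult E c a \<in> fibre E x)"
    using assms(1) unfolding vector_bundle_def by (elim conjE)
  note * = bspec[OF this assms(2)]
  show "fzero E x \<in> fibre E x" using * by (rule conjunct1)
  show "fadd E a b \<in> fibre E x" if "a \<in> fibre E x" "b \<in> fibre E x"
    using * that by simp
  show "fsmult E s a \<in> fibre E x" if "a \<in> fibre E x"
    using * that by simp
qed

lemma lincomb_in_fibre:
  assumes "vector_bundle X E" "x \<in> topspace (stop X)" "\<And>i. i < k \<Longrightarrow> v i \<in> fibre E x"
  shows "lincomb E x k c v \<in> fibre E x"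
  using assms(3)
  by (induction k) (auto intro!: fibre_zero[OF assms(1,2)] fibre_add[OF assms(1,2)]
      fibre_smult[OF assms(1,2)])

lemma coords_carrier:
  assumes "vector_bundle X E" "(U, \<psi>) \<in> triv E" "x \<in> U" "a \<in> fibre E x"
  shows "\<psi> a \<in> carrier_vec (vrank E)"
  using trivialisation_bij[OF assms(1-3)] assms(4) by (rule bij_betwE[THEN bspec])

text \<open>Identities in a fibre are reduced to identities of complex numbers, since a
  trivialisation is injective on each fibre. All later computations with \<open>lincomb\<close> are
  done this way.\<close>

lemma coords_eqI:
  assumes "vector_bundle X E" "(U, \<psi>) \<in> triv E" "x \<in> U" "a \<in> fibre E x" "b \<in> fibre E x"
    and "\<And>m. m < vrank E \<Longrightarrow> Matrix.vec_index (\<psi> a) m = Matrix.vec_index (\<psi> b) m"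
  shows "a = b"
proof -
  have "dim_vec (\<psi> a) = vrank E" "dim_vec (\<psi> b) = vrank E"
    using coords_carrier[OF assms(1-3)] assms(4,5) by (auto intro: carrier_vecD)
  hence "\<psi> a = \<psi> b"
    using assms(6) by (intro eq_vecI) auto
  thus ?thesis
    using bij_betw_imp_inj_on[OF trivialisation_bij[OF assms(1-3)]] assms(4,5)
    by (auto dest: inj_onD)
qed

lemma coords_lincomb:
  assumes "vector_bundle X E" "(U, \<psi>) \<in> triv E" "x \<in> U" "\<And>i. i < k \<Longrightarrow> v i \<in> fibre E x"
    and "m < vrank E"
  shows "Matrix.vec_index (\<psi> (lincomb E x k c v)) m =
    (\<Sum>i<k. c i * Matrix.vec_index (\<psi> (v i)) m)"
  using assms(4)
proof (induction k)
  case 0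
  thus ?case using trivialisation_zero[OF assms(1-3)] assms(5) by simp
next
  case (Suc k)
  have x: "x \<in> topspace (stop X)"
    using trivialisation_open[OF assms(1,2)] assms(3) openin_subset by blast
  \<comment> \<open>Linearity of \<open>\<psi>\<close> is available only for elements of the fibre,
    so the partial sum and the new summand must be shown to lie there.\<close>
  have 1: "lincomb E x k c v \<in> fibre E x"
    using Suc.prems by (intro lincomb_in_fibre[OF assms(1) x]) auto
  have v: "v k \<in> fibre E x" using Suc.prems by simp
  have 2: "fsmult E (c k) (v k) \<in> fibre E x"
    by (rule fibre_smult[OF assms(1) x v])
  have "dim_vec (\<psi> (v k)) = vrank E"
    using coords_carrier[OF assms(1-3) v] by simp
  thus ?case
    using Suc assms(5)
    by (simp add: trivialisation_add[OF assms(1-3) 1 2] trivialisation_smult[OF assms(1-3) v])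
qed

section \<open>Local frames and uniqueness of the rank\<close>

lemma local_frameI:
  assumes "openin (stop X) U" "\<And>i. i < k \<Longrightarrow> e i \<in> F U"
    and "\<And>V t. openin (stop X) V \<Longrightarrow> V \<subseteq> U \<Longrightarrow> t \<in> F V \<Longrightarrow>
      \<exists>a. (\<forall>i<k. holo_fun X V (a i)) \<and>
        (\<forall>x\<in>V. t x = lincomb E x k (\<lambda>i. a i x) (\<lambda>i. e i x))"
    and "\<And>V a i x. openin (stop X) V \<Longrightarrow> V \<subseteq> U \<Longrightarrow> \<forall>i<k. holo_fun X V (a i) \<Longrightarrow>
      \<forall>x\<in>V. lincomb E x k (\<lambda>i. a i x) (\<lambda>i. e i x) = fzero E x \<Longrightarrow> i < k \<Longrightarrow> x \<in> V \<Longrightarrow>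
      a i x = 0"
  shows "local_frame X E F k U e"
  unfolding local_frame_def
  using assms by (intro conjI allI impI ballI; (elim conjE)?) simp_all

lemma local_frame_generates:
  assumes "local_frame X E F k U e" "openin (stop X) V" "V \<subseteq> U" "t \<in> F V"
  obtains a where "\<And>i. i < k \<Longrightarrow> holo_fun X V (a i)"
    "\<And>x. x \<in> V \<Longrightarrow> t x = lincomb E x k (\<lambda>i. a i x) (\<lambda>i. e i x)"
proof -
  have "\<forall>V. openin (stop X) V \<and> V \<subseteq> U \<longrightarrow>
      (\<forall>t\<in>F V. \<exists>a. (\<forall>i<k. holo_fun X V (a i)) \<and>
        (\<forall>x\<in>V. t x = lincomb E x k (\<lambda>i. a i x) (\<lambda>i. e i x)))"
    using assms(1) unfolding local_frame_def by simp
  from bspec[OF mp[OF spec[OF this] conjI[OF assms(2,3)]] assms(4)] show ?thesis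
    using that by auto
qed

lemma local_frame_independent:
  assumes "local_frame X E F k U e" "openin (stop X) V" "V \<subseteq> U"
    and "\<And>i. i < k \<Longrightarrow> holo_fun X V (a i)"
    and "\<And>x. x \<in> V \<Longrightarrow> lincomb E x k (\<lambda>i. a i x) (\<lambda>i. e i x) = fzero E x"
    and "i < k" "x \<in> V"
  shows "a i x = 0"
proof -
  have "\<forall>V. openin (stop X) V \<and> V \<subseteq> U \<longrightarrow>
      (\<forall>a. (\<forall>i<k. holo_fun X V (a i)) \<and>
        (\<forall>x\<in>V. lincomb E x k (\<lambda>i. a i x) (\<lambda>i. e i x) = fzero E x) \<longrightarrow>
        (\<forall>i<k. \<forall>x\<in>V. a i x = 0))"
    using assms(1) unfolding local_frame_def by simp
  from spec[OF mp[OF spec[OF this] conjI[OF assms(2,3)]], of a] show ?thesis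
    using assms(4-7) by simp
qed

text \<open>Over \<open>W\<close> each frame is expanded in the other. Substituting one expansion
  into the other and using the independence of \<open>e\<close> shows that the coefficient matrices
  satisfy \<open>b c = 1\<close> at \<open>p\<close>. The assumptions on \<open>F\<close> are those
  shared by the sheaf of sections and the zero sheaf.\<close>

lemma local_frame_length_le:
  assumes "vector_bundle X E"
    and fib: "\<And>U s x. openin (stop X) U \<Longrightarrow> s \<in> F U \<Longrightarrow> x \<in> U \<Longrightarrow> s x \<in> fibre E x"
    and restr: "\<And>U V s. openin (stop X) U \<Longrightarrow> openin (stop X) V \<Longrightarrow> V \<subseteq> U \<Longrightarrow> s \<in> F U \<Longrightarrow>
      restrict s V \<in> F V"
    and e: "local_frame X E F k U e" "p \<in> U" and f: "local_frame X E F l V f" "p \<in> V"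
  shows "k \<le> l"
proof -
  define W where "W = U \<inter> V"
  have op: "openin (stop X) U" "openin (stop X) V"
    using e(1) f(1) unfolding local_frame_def by auto
  hence W: "openin (stop X) W" "W \<subseteq> U" "W \<subseteq> V" "p \<in> W"
    using e(2) f(2) by (auto simp: W_def)
  have eF: "e i \<in> F U" if "i < k" for i
    using e(1) that unfolding local_frame_def by auto
  have fF: "f j \<in> F V" if "j < l" for j
    using f(1) that unfolding local_frame_def by auto
  have "\<exists>a. (\<forall>j<l. holo_fun X W (a j)) \<and>
      (\<forall>x\<in>W. e i x = lincomb E x l (\<lambda>j. a j x) (\<lambda>j. f j x))" if "i < k" for i
  proof -
    have "restrict (e i) W \<in> F W" by (rule restr[OF op(1) W(1,2) eF[OF that]])
    from local_frame_generates[OF f(1) W(1,3) this] show ?thesis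
      by (metis restrict_apply')
  qed
  then obtain b where b: "\<And>i j. i < k \<Longrightarrow> j < l \<Longrightarrow> holo_fun X W (b i j)"
    "\<And>i x. i < k \<Longrightarrow> x \<in> W \<Longrightarrow> e i x = lincomb E x l (\<lambda>j. b i j x) (\<lambda>j. f j x)"
    by metis
  have "\<exists>a. (\<forall>i<k. holo_fun X W (a i)) \<and>
      (\<forall>x\<in>W. f j x = lincomb E x k (\<lambda>i. a i x) (\<lambda>i. e i x))" if "j < l" for j
  proof -
    have "restrict (f j) W \<in> F W" by (rule restr[OF op(2) W(1,3) fF[OF that]])
    from local_frame_generates[OF e(1) W(1,2) this] show ?thesis
      by (metis restrict_apply')
  qed
  then obtain c where c: "\<And>i j. j < l \<Longrightarrow> i < k \<Longrightarrow> holo_fun X W (c j i)"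
    "\<And>j x. j < l \<Longrightarrow> x \<in> W \<Longrightarrow> f j x = lincomb E x k (\<lambda>i. c j i x) (\<lambda>i. e i x)"
    by metis
  have "(\<Sum>j<l. b i j p * c j m p) = (if i = m then 1 else 0)" if i: "i < k" and m: "m < k" for i m
  proof -
    \<comment> \<open>This is row \<open>i\<close> of \<open>b c - 1\<close>: the coefficients, with
      respect to \<open>e\<close>, of the re-expansion of \<open>e i\<close> minus
      \<open>e i\<close> itself. They are holomorphic and the combination is zero, so independence
      makes them vanish.\<close>
    define a where "a m x = (\<Sum>j<l. b i j x * c j m x) - (if i = m then 1 else 0)" for m x
    have "holo_fun X W (a m)" if "m < k" for m
      unfolding a_def using that i
      by (intro holo_fun_diff holo_fun_sum holo_fun_mult holo_fun_const b c) auto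
    moreover have "lincomb E x k (\<lambda>m. a m x) (\<lambda>m. e m x) = fzero E x" if x: "x \<in> W" for x
    proof -
      have xX: "x \<in> topspace (stop X)" using x W(1) openin_subset by blast
      obtain T \<psi> where T: "(T, \<psi>) \<in> triv E" "x \<in> T"
        using trivialisation_exists[OF assms(1) xX] .
      have ef: "e m x \<in> fibre E x" if "m < k" for m
        using fib[OF op(1) eF[OF that]] x W(2) by auto
      have ff: "f j x \<in> fibre E x" if "j < l" for j
        using fib[OF op(2) fF[OF that]] x W(3) by auto
      show ?thesis
      proof (rule coords_eqI[OF assms(1) T])
        show "lincomb E x k (\<lambda>m. a m x) (\<lambda>m. e m x) \<in> fibre E x"
          by (intro lincomb_in_fibre[OF assms(1) xX] ef)
        show "fzero E x \<in> fibre E x" by (rule fibre_zero[OF assms(1) xX])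
        fix q assume q: "q < vrank E"
        let ?e = "\<lambda>m. Matrix.vec_index (\<psi> (e m x)) q"
        have 1: "?e i = (\<Sum>j<l. b i j x * Matrix.vec_index (\<psi> (f j x)) q)"
          unfolding b(2)[OF i x] by (rule coords_lincomb[OF assms(1) T ff q])
        have 2: "Matrix.vec_index (\<psi> (f j x)) q = (\<Sum>m<k. c j m x * ?e m)" if "j < l" for j
          unfolding c(2)[OF that x] by (rule coords_lincomb[OF assms(1) T ef q])
        have "Matrix.vec_index (\<psi> (lincomb E x k (\<lambda>m. a m x) (\<lambda>m. e m x))) q =
            (\<Sum>m<k. a m x * ?e m)"
          by (rule coords_lincomb[OF assms(1) T ef q])
        also have "\<dots> = (\<Sum>m<k. (\<Sum>j<l. b i j x * c j m x * ?e m)) -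
            (\<Sum>m<k. (if i = m then 1 else 0) * ?e m)"
          unfolding a_def by (simp only: left_diff_distrib sum_distrib_right sum_subtractf)
        also have "(\<Sum>m<k. (if i = m then 1 else 0) * ?e m) = ?e i"
          using i by (simp add: if_distrib [of "\<lambda>y. y * _"] sum.delta cong: if_cong)
        \<comment> \<open>After the sums are exchanged, the inner sum over \<open>m\<close> gives
          \<open>f j\<close> by \<open>2\<close>, and the outer sum over \<open>j\<close> gives
          \<open>e i\<close> by \<open>1\<close>.\<close>
        also have "(\<Sum>m<k. (\<Sum>j<l. b i j x * c j m x * ?e m)) = ?e i"
          by (subst sum.swap, subst 1) (simp add: 2 sum_distrib_left mult.assoc)
        finally show "Matrix.vec_index (\<psi> (lincomb E x k (\<lambda>m. a m x) (\<lambda>m. e m x))) q =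
            Matrix.vec_index (\<psi> (fzero E x)) q"
          using q trivialisation_zero[OF assms(1) T] by simp
      qed
    qed
    ultimately have "a m p = 0"
      using local_frame_independent[OF e(1) W(1,2) _ _ m W(4)] by blast
    thus ?thesis by (simp add: a_def)
  qed
  thus ?thesis by (rule right_inverse_imp_le)
qed

text \<open>Comparing two frames at one common point in both directions gives the uniqueness
  demanded by the definite description. Nonemptiness supplies that point; over an empty space every
  number would satisfy the description.\<close>

lemma sheaf_rank_eqI:
  assumes "vector_bundle X E" "topspace (stop X) \<noteq> {}"
    and "\<And>U s x. openin (stop X) U \<Longrightarrow> s \<in> F U \<Longrightarrow> x \<in> U \<Longrightarrow> s x \<in> fibre E x"
    and "\<And>U V s. openin (stop X) U \<Longrightarrow> openin (stop X) V \<Longrightarrow> V \<subseteq> U \<Longrightarrow> s \<in> F U \<Longrightarrow>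
      restrict s V \<in> F V"
    and "\<And>p. p \<in> topspace (stop X) \<Longrightarrow> \<exists>U e. p \<in> U \<and> local_frame X E F k U e"
  shows "sheaf_rank X E F = k"
  unfolding sheaf_rank_def
proof (rule the_equality)
  show "\<forall>p\<in>topspace (stop X). \<exists>U e. p \<in> U \<and> local_frame X E F k U e"
    using assms(5) by blast
next
  fix l assume l: "\<forall>p\<in>topspace (stop X). \<exists>U e. p \<in> U \<and> local_frame X E F l U e"
  obtain p where "p \<in> topspace (stop X)" using assms(2) by blast
  then obtain U e V f where "p \<in> U" "local_frame X E F k U e" "p \<in> V" "local_frame X E F l V f"
    using l assms(5) by metis
  moreover have "a \<le> b"
    if "local_frame X E F a U e" "p \<in> U" "local_frame X E F b V f" "p \<in> V" for a b U V e f
    by (rule local_frame_length_le[OF assms(1) _ _ that]) (fact assms(3), fact assms(4))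
  ultimately show "l = k" by (meson le_antisym)
qed

section \<open>The sheaf of sections and its rank\<close>

lemma sectionsI:
  assumes "s \<in> (\<Pi>\<^sub>E x\<in>U. fibre E x)"
    and "\<And>V \<psi> i. (V, \<psi>) \<in> triv E \<Longrightarrow> i < vrank E \<Longrightarrow>
      holo_fun X (U \<inter> V) (\<lambda>x. Matrix.vec_index (\<psi> (s x)) i)"
  shows "s \<in> sections X E U"
  using assms unfolding sections_def by blast

lemma sections_restrict:
  assumes "compact_riemann_surface X" "s \<in> sections X E U" "V \<subseteq> U"
  shows "restrict s V \<in> sections X E V"
proof (rule sectionsI)
  show "restrict s V \<in> (\<Pi>\<^sub>E x\<in>V. fibre E x)"
    using assms(2,3) unfolding sections_def by auto
  fix W \<psi> i assume *: "(W, \<psi>) \<in> triv E" "i < vrank E"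
  have "holo_fun X (U \<inter> W) (\<lambda>x. Matrix.vec_index (\<psi> (s x)) i)"
    using assms(2) * unfolding sections_def by blast
  hence "holo_fun X (V \<inter> W) (\<lambda>x. Matrix.vec_index (\<psi> (s x)) i)"
    by (rule holo_fun_subset) (use assms(3) in auto)
  thus "holo_fun X (V \<inter> W) (\<lambda>x. Matrix.vec_index (\<psi> (restrict s V x)) i)"
    by (rule holo_fun_cong[OF assms(1), rotated]) auto
qed

text \<open>The frame consists of the preimages of the unit vectors under \<open>\<psi>\<close>. The
  coefficients of a section with respect to it are the section's coordinates under
  \<open>\<psi>\<close>.\<close>

lemma trivialisation_local_frame:
  assumes "compact_riemann_surface X" "vector_bundle X E" "(U, \<psi>) \<in> triv E"
  shows "local_frame X E (sections X E) (vrank E) U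
    (\<lambda>i. \<lambda>x\<in>U. inv_into (fibre E x) \<psi> (unit_vec (vrank E) i))"
proof -
  define r where "r = vrank E"
  define e where "e i = (\<lambda>x\<in>U. inv_into (fibre E x) \<psi> (unit_vec r i))" for i
  have op: "openin (stop X) U" by (rule trivialisation_open[OF assms(2,3)])
  have ef: "e i x \<in> fibre E x" and \<psi>e: "\<psi> (e i x) = unit_vec r i" if "x \<in> U" for i x
  proof -
    have "unit_vec r i \<in> \<psi> ` fibre E x"
      using trivialisation_bij[OF assms(2,3) that] by (simp add: bij_betw_def r_def)
    thus "e i x \<in> fibre E x" "\<psi> (e i x) = unit_vec r i"
      using that by (auto simp: e_def inv_into_into f_inv_into_f)
  qed
  \<comment> \<open>Coefficients are recovered as coordinates; this yields both generation and
    independence.\<close>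
  have coords: "Matrix.vec_index (\<psi> (lincomb E x r c (\<lambda>i. e i x))) m = c m"
    if "x \<in> U" "m < r" for x m c
  proof -
    have "Matrix.vec_index (\<psi> (lincomb E x r c (\<lambda>i. e i x))) m =
        (\<Sum>i<r. c i * Matrix.vec_index (\<psi> (e i x)) m)"
      using that by (intro coords_lincomb[OF assms(2,3)] ef) (auto simp: r_def)
    also have "\<dots> = (\<Sum>i<r. if i = m then c i else 0)"
      using that by (intro sum.cong) (auto simp: \<psi>e)
    finally show ?thesis using that by simp
  qed
  have "local_frame X E (sections X E) r U e"
  proof (rule local_frameI[OF op])
    show "e i \<in> sections X E U" if i: "i < r" for i
    proof (rule sectionsI)
      show "e i \<in> (\<Pi>\<^sub>E x\<in>U. fibre E x)" using ef by (auto simp: e_def)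
      fix V \<theta> m assume V: "(V, \<theta>) \<in> triv E" and m: "m < vrank E"
      obtain A where A: "holo_mat X (U \<inter> V) r r A"
        "\<And>x a. x \<in> U \<inter> V \<Longrightarrow> a \<in> fibre E x \<Longrightarrow> \<theta> a = A x *\<^sub>v \<psi> a"
        using transition_matrix[OF assms(2,3) V] unfolding r_def by blast
      \<comment> \<open>Under \<open>\<theta>\<close> the coordinates of \<open>e i\<close> form
        column \<open>i\<close> of the transition matrix, which is holomorphic.\<close>
      have "holo_fun X (U \<inter> V) (\<lambda>x. Matrix.index_mat (A x) (m, i))"
        using A(1) m i unfolding holo_mat_def r_def by blast
      thus "holo_fun X (U \<inter> V) (\<lambda>x. Matrix.vec_index (\<theta> (e i x)) m)"
      proof (rule holo_fun_cong[OF assms(1), rotated])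
        fix x assume x: "x \<in> U \<inter> V"
        have "A x \<in> carrier_mat r r" using A(1) x unfolding holo_mat_def by blast
        thus "Matrix.index_mat (A x) (m, i) = Matrix.vec_index (\<theta> (e i x)) m"
          using x m i ef[of x i] by (simp add: A(2) \<psi>e r_def scalar_prod_right_unit)
      qed
    qed
    show "\<exists>a. (\<forall>i<r. holo_fun X V (a i)) \<and>
        (\<forall>x\<in>V. t x = lincomb E x r (\<lambda>i. a i x) (\<lambda>i. e i x))"
      if V: "openin (stop X) V" "V \<subseteq> U" and t: "t \<in> sections X E V" for V t
    proof (intro exI[of _ "\<lambda>i x. Matrix.vec_index (\<psi> (t x)) i"] conjI allI impI ballI)
      have "V \<inter> U = V" using V by blast
      thus "holo_fun X V (\<lambda>x. Matrix.vec_index (\<psi> (t x)) i)" if "i < r" for i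
        using t assms(3) that unfolding sections_def r_def by force
      fix x assume x: "x \<in> V"
      hence xU: "x \<in> U" and xX: "x \<in> topspace (stop X)"
        using V openin_subset by blast+
      show "t x = lincomb E x r (\<lambda>i. Matrix.vec_index (\<psi> (t x)) i) (\<lambda>i. e i x)"
      proof (rule coords_eqI[OF assms(2,3) xU])
        show "t x \<in> fibre E x" using t x unfolding sections_def by auto
        show "lincomb E x r (\<lambda>i. Matrix.vec_index (\<psi> (t x)) i) (\<lambda>i. e i x) \<in> fibre E x"
          using ef xU by (intro lincomb_in_fibre[OF assms(2) xX])
      qed (use coords[OF xU] in \<open>simp add: r_def\<close>)
    qed
    show "a i x = 0"
      if V: "V \<subseteq> U" and z: "\<forall>x\<in>V. lincomb E x r (\<lambda>i. a i x) (\<lambda>i. e i x) = fzero E x"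
        and "i < r" "x \<in> V" for V a i x
    proof -
      have xU: "x \<in> U" using that by blast
      have "a i x = Matrix.vec_index (\<psi> (lincomb E x r (\<lambda>i. a i x) (\<lambda>i. e i x))) i"
        using coords[OF xU \<open>i < r\<close>] by simp
      also have "\<dots> = Matrix.vec_index (\<psi> (fzero E x)) i" using z \<open>x \<in> V\<close> by simp
      finally show ?thesis
        using trivialisation_zero[OF assms(2,3) xU] \<open>i < r\<close> by (simp add: r_def)
    qed
  qed
  thus ?thesis unfolding e_def r_def .
qed

text \<open>This links the rank in the type of a chain with the rank in the slope of a subchain. For
  degrees the link is the definition of \<open>bundle_degree\<close>.\<close>

lemma sheaf_rank_sections:
  assumes "compact_riemann_surface X" "vector_bundle X E"
  shows "sheaf_rank X E (sections X E) = vrank E"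
proof (rule sheaf_rank_eqI[OF assms(2)])
  show "topspace (stop X) \<noteq> {}"
    using assms(1) unfolding compact_riemann_surface_def by blast
  show "s x \<in> fibre E x" if "s \<in> sections X E U" "x \<in> U" for U s x
    using that unfolding sections_def by auto
  show "restrict s V \<in> sections X E V" if "V \<subseteq> U" "s \<in> sections X E U" for U V s
    using sections_restrict[OF assms(1)] that by blast
  fix p assume "p \<in> topspace (stop X)"
  then obtain U \<psi> where "(U, \<psi>) \<in> triv E" "p \<in> U"
    using trivialisation_exists[OF assms(2)] by metis
  thus "\<exists>U e. p \<in> U \<and> local_frame X E (sections X E) (vrank E) U e"
    using trivialisation_local_frame[OF assms] by blast
qed

section \<open>Rank and degree of the zero sheaf\<close>

text \<open>The empty family is a frame over all of \<open>X\<close>, because \<open>lincomb\<close>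
  of length 0 is \<open>fzero\<close>.\<close>

lemma zero_sheaf_local_frame:
  "local_frame X E (zero_sheaf E) 0 (topspace (stop X)) e"
  unfolding local_frame_def zero_sheaf_def by auto

lemma sheaf_rank_zero_sheaf:
  assumes "compact_riemann_surface X" "vector_bundle X E"
  shows "sheaf_rank X E (zero_sheaf E) = 0"
proof (rule sheaf_rank_eqI[OF assms(2)])
  show "topspace (stop X) \<noteq> {}"
    using assms(1) unfolding compact_riemann_surface_def by blast
  show "s x \<in> fibre E x" if "openin (stop X) U" "s \<in> zero_sheaf E U" "x \<in> U" for U s x
    using that fibre_zero[OF assms(2)] openin_subset unfolding zero_sheaf_def by fastforce
  show "restrict s V \<in> zero_sheaf E V" if "V \<subseteq> U" "s \<in> zero_sheaf E U" for U V s
    using that unfolding zero_sheaf_def by (auto simp: Int_absorb1)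
  show "\<exists>U e. p \<in> U \<and> local_frame X E (zero_sheaf E) 0 U e" if "p \<in> topspace (stop X)" for p
    using zero_sheaf_local_frame that by blast
qed

text \<open>The empty determinant is the constant 1, whose order is 0 at every point.\<close>

lemma wedge_order_length_0:
  assumes "wedge_order X E F 0 S s p m"
  shows "m = 0"
proof -
  have "zorder (\<lambda>w. Determinant.det (Matrix.mat 0 0 (h w))) z = 0" for h and z :: complex
    by (simp add: det_dim_zero)
  thus ?thesis
    using assms unfolding wedge_order_def by (auto simp: Let_def)
qed

text \<open>Since the rank is 0, every admissible \<open>ord\<close> vanishes on \<open>X\<close>,
  so 0 is the only candidate. It also has to be attained for the definite description to denote
  it.\<close>

lemma sheaf_degree_zero_sheaf:
  assumes "compact_riemann_surface X" "vector_bundle X E"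
  shows "sheaf_degree X E (zero_sheaf E) = 0"
  unfolding sheaf_degree_def sheaf_rank_zero_sheaf[OF assms]
proof (rule the_equality)
  \<comment> \<open>For attainment, take no poles and the empty frame; a chart at \<open>p\<close>
    is chosen only to read off the order of the constant 1.\<close>
  have "wedge_order X E (zero_sheaf E) 0 {} s p 0" if p: "p \<in> topspace (stop X)" for s p
  proof -
    obtain V z where "(V, z) \<in> charts X" "p \<in> V"
      using assms(1) p unfolding compact_riemann_surface_def by blast
    thus ?thesis
      unfolding wedge_order_def
      using zero_sheaf_local_frame[of X E] p
      by (intro exI[of _ "topspace (stop X)"] exI[of _ undefined] bexI[of _ "(V, z)"])
        (auto simp: det_dim_zero)
  qed
  thus "\<exists>S s ord. finite S \<and> S \<subseteq> topspace (stop X) \<and>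
      (\<forall>i<0. s i \<in> zero_sheaf E (topspace (stop X) - S)) \<and>
      (\<forall>p\<in>topspace (stop X). wedge_order X E (zero_sheaf E) 0 S s p (ord p)) \<and>
      finite {p \<in> topspace (stop X). ord p \<noteq> 0} \<and>
      0 = (\<Sum>p | p \<in> topspace (stop X) \<and> ord p \<noteq> 0. ord p)"
    by (intro exI[of _ "{}"] exI[of _ undefined] exI[of _ "\<lambda>_. 0"]) auto
next
  fix d assume "\<exists>S s ord. finite S \<and> S \<subseteq> topspace (stop X) \<and>
      (\<forall>i<0. s i \<in> zero_sheaf E (topspace (stop X) - S)) \<and>
      (\<forall>p\<in>topspace (stop X). wedge_order X E (zero_sheaf E) 0 S s p (ord p)) \<and>
      finite {p \<in> topspace (stop X). ord p \<noteq> 0} \<and>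
      d = (\<Sum>p | p \<in> topspace (stop X) \<and> ord p \<noteq> 0. ord p)"
  then obtain S s ord where
    w: "\<forall>p\<in>topspace (stop X). wedge_order X E (zero_sheaf E) 0 S s p (ord p)"
    and d: "d = (\<Sum>p | p \<in> topspace (stop X) \<and> ord p \<noteq> 0. ord p)"
    by blast
  have "ord p = 0" if "p \<in> topspace (stop X)" for p
    using w that by (intro wedge_order_length_0) (rule bspec)
  hence "{p. p \<in> topspace (stop X) \<and> ord p \<noteq> 0} = {}" by blast
  thus "d = 0" unfolding d by (simp only: sum.empty)
qed

section \<open>Bundles of rank zero\<close>

text \<open>With no coordinates to compare, each fibre is the single point \<open>fzero E x\<close>.
  This translates nontriviality, a statement about sheaves, into positivity of ranks.\<close>

lemma sections_vrank_0:
  assumes "vector_bundle X E" "vrank E = 0"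
  shows "sheaf_eq X (sections X E) (zero_sheaf E)"
  unfolding sheaf_eq_def
proof safe
  fix U s assume U: "openin (stop X) U"
  have eq: "a = fzero E x" if "x \<in> U" "a \<in> fibre E x" for a x
  proof -
    have x: "x \<in> topspace (stop X)" using U that openin_subset by blast
    obtain T \<psi> where T: "(T, \<psi>) \<in> triv E" "x \<in> T"
      using trivialisation_exists[OF assms(1) x] .
    show ?thesis
      by (rule coords_eqI[OF assms(1) T that(2) fibre_zero[OF assms(1) x]]) (simp add: assms(2))
  qed
  {
    assume "s \<in> sections X E U"
    hence "s \<in> (\<Pi>\<^sub>E x\<in>U. fibre E x)" unfolding sections_def by blast
    \<comment> \<open>Both sides are \<open>undefined\<close> outside \<open>U\<close>, so agreement
      on \<open>U\<close> suffices.\<close>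
    hence "s = (\<lambda>x\<in>U. fzero E x)"
      using eq by (intro extensionalityI[of s U]) (auto simp: PiE_iff)
    thus "s \<in> zero_sheaf E U" unfolding zero_sheaf_def by simp
  next
    assume "s \<in> zero_sheaf E U"
    moreover have "fzero E x \<in> fibre E x" if "x \<in> U" for x
      using that U openin_subset fibre_zero[OF assms(1)] by blast
    ultimately show "s \<in> sections X E U"
      unfolding sections_def zero_sheaf_def using assms(2) by auto
  }
qed

section \<open>Slopes of the standard subchains\<close>

text \<open>Beyond \<open>i\<close> each weight \<open>\<alpha> j\<close> is multiplied by rank 0
  and the degree is 0, so these indices contribute to neither sum.\<close>

lemma slope_truncate:
  assumes "i \<le> n"
  shows "slope n \<alpha> (\<lambda>j. if j \<le> i then r j else 0) (\<lambda>j. if j \<le> i then d j else 0) = slope i \<alpha> r d"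
proof -
  have "(\<Sum>j\<le>n. real_of_int (if j \<le> i then d j else 0) + \<alpha> j * real (if j \<le> i then r j else 0)) =
      (\<Sum>j\<le>i. real_of_int (d j) + \<alpha> j * real (r j))"
    using assms by (intro sum.mono_neutral_cong_right) auto
  moreover have "(\<Sum>j\<le>n. real (if j \<le> i then r j else 0)) = (\<Sum>j\<le>i. real (r j))"
    using assms by (intro sum.mono_neutral_cong_right) auto
  ultimately show ?thesis unfolding slope_def by simp
qed

lemma subchain_slope_standard_subchain:
  assumes "compact_riemann_surface X" "holomorphic_chain X n E \<phi>" "i \<le> n"
  shows "subchain_slope X n \<alpha> E (standard_subchain X E i) =
    slope i \<alpha> (\<lambda>j. vrank (E j)) (\<lambda>j. bundle_degree X (E j))"
proof -
  have vb: "vector_bundle X (E j)" if "j \<le> n" for j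
    using assms(2) that unfolding holomorphic_chain_def by blast
  \<comment> \<open>The \<open>E j\<close> are known to be bundles only for
    \<open>j \<le> n\<close>; the slopes are therefore compared summand by summand.\<close>
  have "subchain_slope X n \<alpha> E (standard_subchain X E i) =
      slope n \<alpha> (\<lambda>j. if j \<le> i then vrank (E j) else 0)
        (\<lambda>j. if j \<le> i then bundle_degree X (E j) else 0)"
    unfolding subchain_slope_def slope_def standard_subchain_def bundle_degree_def
    by (intro arg_cong2[of _ _ _ _ "(/)"] sum.cong)
      (auto simp: vb sheaf_rank_sections[OF assms(1)] sheaf_rank_zero_sheaf[OF assms(1)]
        sheaf_degree_zero_sheaf[OF assms(1)])
  thus ?thesis by (simp add: slope_truncate[OF assms(3)])
qed

text \<open>If all bundles up to \<open>i\<close> had rank 0, the subchain would be zero; if all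
  later ones had rank 0, it would be the whole chain.\<close>

lemma nontrivial_standard_subchain_ranks:
  assumes "holomorphic_chain X n E \<phi>" "i < n"
    and "nontrivial_subchain X n E \<phi> (standard_subchain X E i)"
  shows "\<exists>j\<le>i. vrank (E j) > 0" "\<exists>j\<in>{i+1..n}. vrank (E j) > 0"
proof -
  have vb: "vector_bundle X (E j)" if "j \<le> n" for j
    using assms(1) that unfolding holomorphic_chain_def by blast
  \<comment> \<open>Beyond \<open>i\<close> the subchain is zero, so this \<open>j\<close> is at
    most \<open>i\<close>.\<close>
  obtain j where "j \<le> n" "\<not> sheaf_eq X (standard_subchain X E i j) (zero_sheaf (E j))"
    using assms(3) unfolding nontrivial_subchain_def by blast
  thus "\<exists>j\<le>i. vrank (E j) > 0"
    using sections_vrank_0[OF vb]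
    by (auto simp: standard_subchain_def sheaf_eq_def split: if_splits)
  \<comment> \<open>Up to \<open>i\<close> the subchain agrees with the chain, so this
    \<open>j\<close> lies beyond \<open>i\<close>.\<close>
  obtain j where "j \<le> n" "\<not> sheaf_eq X (standard_subchain X E i j) (sections X (E j))"
    using assms(3) unfolding nontrivial_subchain_def by blast
  thus "\<exists>j\<in>{i+1..n}. vrank (E j) > 0"
    using sections_vrank_0[OF vb, of j]
    by (intro bexI[of _ j]) (auto simp: standard_subchain_def sheaf_eq_def split: if_splits)
qed

text \<open>Cross-multiplying \<open>(d1 + a1) / r1\<close> with
  \<open>(d1 + a1 + (d2 + a2)) / (r1 + r2)\<close> and cancelling \<open>(d1 + a1) * r1\<close>
  leaves \<open>(d1 + a1) * r2\<close> against \<open>(d2 + a2) * r1\<close>, which rearranges to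
  \<open>L\<close> against \<open>R\<close>.\<close>

lemma slope_truncate_compare:
  fixes \<alpha> :: "nat \<Rightarrow> real" and r :: "nat \<Rightarrow> nat" and d :: "nat \<Rightarrow> int"
  assumes "i < n" "\<alpha> 0 = 0" "\<exists>j\<le>i. r j > 0" "\<exists>j\<in>{i+1..n}. r j > 0"
  defines "L \<equiv> (\<Sum>j=1..i. \<alpha> j * real (r j)) * (\<Sum>j=i+1..n. real (r j))
      - (\<Sum>j=i+1..n. \<alpha> j * real (r j)) * (\<Sum>j=0..i. real (r j))"
    and "R \<equiv> (\<Sum>j=0..i. real (r j)) * (\<Sum>j=i+1..n. real_of_int (d j))
      - (\<Sum>j=i+1..n. real (r j)) * (\<Sum>j=0..i. real_of_int (d j))"
  shows "slope i \<alpha> r d \<le> slope n \<alpha> r d \<longleftrightarrow> L \<le> R" "slope i \<alpha> r d < slope n \<alpha> r d \<longleftrightarrow> L < R"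
proof -
  define r1 r2 where "r1 = (\<Sum>j=0..i. real (r j))" and "r2 = (\<Sum>j=i+1..n. real (r j))"
  define d1 d2 where "d1 = (\<Sum>j=0..i. real_of_int (d j))"
    and "d2 = (\<Sum>j=i+1..n. real_of_int (d j))"
  define a1 a2 where "a1 = (\<Sum>j=1..i. \<alpha> j * real (r j))"
    and "a2 = (\<Sum>j=i+1..n. \<alpha> j * real (r j))"
  have pos: "r1 > 0" "r2 > 0"
    using assms(3,4) unfolding r1_def r2_def
    by (force intro!: sum_pos2)+
  have split: "sum f {..n} = sum f {0..i} + sum f {i+1..n}" for f :: "nat \<Rightarrow> real"
    using sum.ub_add_nat[of 0 i f "n - i"] assms(1) by (simp add: atMost_atLeast0)
  \<comment> \<open>The summand at 0 vanishes because \<open>\<alpha> 0 = 0\<close>; this is why the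
    sum in \<open>L\<close> may start at 1.\<close>
  have a0: "(\<Sum>j=0..i. \<alpha> j * real (r j)) = a1"
    unfolding a1_def using assms(2) by (simp add: sum.atLeast_Suc_atMost)
  have 1: "slope i \<alpha> r d = (d1 + a1) / r1"
    unfolding slope_def by (simp add: atMost_atLeast0 sum.distrib a0 d1_def r1_def)
  have 2: "slope n \<alpha> r d = (d1 + a1 + (d2 + a2)) / (r1 + r2)"
    unfolding slope_def split by (simp add: sum.distrib a0 d1_def r1_def d2_def a2_def r2_def)
  have LR: "L = a1 * r2 - a2 * r1" "R = r1 * d2 - r2 * d1"
    by (simp_all add: L_def R_def a1_def a2_def r1_def r2_def d1_def d2_def)
  show "slope i \<alpha> r d \<le> slope n \<alpha> r d \<longleftrightarrow> L \<le> R" "slope i \<alpha> r d < slope n \<alpha> r d \<longleftrightarrow> L < R"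
    unfolding 1 2 LR using pos
    by (simp_all add: pos_divide_le_eq pos_le_divide_eq pos_divide_less_eq pos_less_divide_eq
        add_pos_pos) (simp_all add: algebra_simps)
qed

section \<open>Conditions on the parameters from (semi)stability\<close>

theorem proposition2p4:
  fixes X :: "'a surface" and g n :: nat
    and E :: "nat \<Rightarrow> ('a, 'e) vbundle" and \<phi> :: "nat \<Rightarrow> 'e \<Rightarrow> 'e"
    and r :: "nat \<Rightarrow> nat" and d :: "nat \<Rightarrow> int" and \<alpha> :: "nat \<Rightarrow> real"
  assumes "compact_riemann_surface X" and "has_genus X g" and "g \<ge> 2"
    and "holomorphic_chain X n E \<phi>" and "chain_type X n E r d"
    and "\<alpha> 0 = 0"
  shows "let
      lhs = (\<lambda>i. (\<Sum>j=1..i. \<alpha> j * real (r j)) * (\<Sum>j=i+1..n. real (r j))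
               - (\<Sum>j=i+1..n. \<alpha> j * real (r j)) * (\<Sum>j=0..i. real (r j)));
      rhs = (\<lambda>i. (\<Sum>j=0..i. real (r j)) * (\<Sum>j=i+1..n. real_of_int (d j))
               - (\<Sum>j=i+1..n. real (r j)) * (\<Sum>j=0..i. real_of_int (d j)));
      C = standard_subchain X E
    in
      (\<forall>i<n. nontrivial_subchain X n E \<phi> (C i) \<longrightarrow>
         (subchain_slope X n \<alpha> E (C i) \<le> chain_slope X n \<alpha> E \<longleftrightarrow> lhs i \<le> rhs i) \<and>
         (subchain_slope X n \<alpha> E (C i) < chain_slope X n \<alpha> E \<longleftrightarrow> lhs i < rhs i)) \<and>
      (semistable_chain X n \<alpha> E \<phi> \<longrightarrow>
         (\<forall>i<n. nontrivial_subchain X n E \<phi> (C i) \<longrightarrow> lhs i \<le> rhs i)) \<and>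
      (stable_chain X n \<alpha> E \<phi> \<longrightarrow>
         (\<forall>i<n. nontrivial_subchain X n E \<phi> (C i) \<longrightarrow> lhs i < rhs i))"
proof -
  have slope: "(subchain_slope X n \<alpha> E (standard_subchain X E i) \<le> chain_slope X n \<alpha> E \<longleftrightarrow>
        (\<Sum>j=1..i. \<alpha> j * real (r j)) * (\<Sum>j=i+1..n. real (r j))
          - (\<Sum>j=i+1..n. \<alpha> j * real (r j)) * (\<Sum>j=0..i. real (r j))
        \<le> (\<Sum>j=0..i. real (r j)) * (\<Sum>j=i+1..n. real_of_int (d j))
          - (\<Sum>j=i+1..n. real (r j)) * (\<Sum>j=0..i. real_of_int (d j))) \<and>
      (subchain_slope X n \<alpha> E (standard_subchain X E i) < chain_slope X n \<alpha> E \<longleftrightarrow>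
        (\<Sum>j=1..i. \<alpha> j * real (r j)) * (\<Sum>j=i+1..n. real (r j))
          - (\<Sum>j=i+1..n. \<alpha> j * real (r j)) * (\<Sum>j=0..i. real (r j))
        < (\<Sum>j=0..i. real (r j)) * (\<Sum>j=i+1..n. real_of_int (d j))
          - (\<Sum>j=i+1..n. real (r j)) * (\<Sum>j=0..i. real_of_int (d j)))"
    if i: "i < n" and nt: "nontrivial_subchain X n E \<phi> (standard_subchain X E i)" for i
  proof -
    have type: "vrank (E j) = r j" "bundle_degree X (E j) = d j" if "j \<le> n" for j
      using assms(5) that unfolding chain_type_def by auto
    have "chain_slope X n \<alpha> E = slope n \<alpha> r d"
      unfolding chain_slope_def slope_def by (simp add: type)
    moreover have "subchain_slope X n \<alpha> E (standard_subchain X E i) = slope i \<alpha> r d"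
      using i subchain_slope_standard_subchain[OF assms(1,4), of i \<alpha>]
      by (simp add: slope_def type)
    moreover have "\<exists>j\<le>i. r j > 0" "\<exists>j\<in>{i+1..n}. r j > 0"
      using nontrivial_standard_subchain_ranks[OF assms(4) i nt] i type by force+
    ultimately show ?thesis
      using slope_truncate_compare[where \<alpha> = \<alpha> and r = r and d = d, OF i assms(6)] by simp
  qed
  \<comment> \<open>Semistability and stability are instantiated at the nontrivial standard
    subchain, and the two equivalences turn the slope inequalities into the stated ones.\<close>
  show ?thesis
    unfolding Let_def semistable_chain_def stable_chain_def using slope by blast
qed

end
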